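(* Let $a<b$ and let $g(x)=\sum_{l=0}^m c_l(x-a)^l$ be a real polynomial of degree $m$, restricted to the interval $[a,b]$. Define $c_{\max}:=\max_{l=2,\dots,m}|c_l|$ (with $c_{\max}:=0$ if $m<2$). For $n>m$ and $k=0,\dots,n$, let $w_{n,k}$ be the Bernstein coefficients of $g$ in $\mathbb{P}_n[a,b]$, so that $$g(x)=\sum_{k=0}^n w_{n,k}\binom{n}{k}\frac{(x-a)^k(b-x)^{n-k}}{(b-a)^n}.$$ Then $$\left|g\left(a+\frac{k}{n}(b-a)\right)-w_{n,k}\right|\le\frac{m^3\,c_{\max}\,\max\{(b-a)^2,(b-a)^m\}}{n}.$$
   Context: $\mathbb{P}_n[a,b]$ is the space of real polynomials of degree at most $n$ on $[a,b]$. *)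

theory Defs
  imports "HOL-Analysis.Analysis" "HOL-Computational_Algebra.Polynomial"
begin

text \<open>\<open>w 0, \<dots>, w n\<close> are the coefficients of \<open>f\<close> in the Bernstein basis of the polynomials of
  degree at most \<open>n\<close> on \<open>[a,b]\<close>; the values \<open>w k\<close> for \<open>k > n\<close> are irrelevant.\<close>

definition bernstein_coeffs :: "real \<Rightarrow> real \<Rightarrow> nat \<Rightarrow> (real \<Rightarrow> real) \<Rightarrow> (nat \<Rightarrow> real) \<Rightarrow> bool" where
  "bernstein_coeffs a b n f w \<longleftrightarrow>
     (\<forall>x\<in>{a..b}. f x =
        (\<Sum>k=0..n. w k * real (n choose k) * ((x - a) ^ k * (b - x) ^ (n - k) / (b - a) ^ n)))"

definition c_max :: "(nat \<Rightarrow> real) \<Rightarrow> nat \<Rightarrow> real" where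
  "c_max c m = (if m < 2 then 0 else Max ((\<lambda>l. \<bar>c l\<bar>) ` {2..m}))"

end

theory Submission
  imports Defs
begin

text \<open>Put \<open>h = b - a\<close>. The binomial theorem for \<open>h = (x - a) + (b - x)\<close> shows that \<open>(x - a) ^ l\<close>
  has Bernstein coefficients \<open>h ^ l * (k choose l) / (n choose l)\<close>
  (lemma \<open>bernstein_coeffs_monomial\<close>), and Bernstein coefficients are unique
  (lemma \<open>bernstein_coeffs_unique\<close>). Hence
  \<open>w k = (\<Sum>l\<le>m. c l * h ^ l * ((k choose l) / (n choose l)))\<close>, while the value of the polynomial at the
  \<open>k\<close>-th node is \<open>(\<Sum>l\<le>m. c l * h ^ l * (k / n) ^ l)\<close>.

  The ratio \<open>(k choose l) / (n choose l)\<close> is the product of the factors \<open>(k - i) / (n - i)\<close> for \<open>i < l\<close>.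
  Up to \<open>i = k\<close>, where the product becomes \<open>0\<close>, the \<open>i\<close>-th factor differs from \<open>k / n\<close> by at most
  \<open>i / n\<close>, and the partial products stay in \<open>[0, 1]\<close>. Therefore the two sums differ in the \<open>l\<close>-th term by at most
  \<open>\<bar>c l\<bar> * h ^ l * l * (l - 1) / (2 * n)\<close> (lemma \<open>power_diff_binomial_ratio_bounds\<close>). This vanishes for
  \<open>l < 2\<close>, and for each of the at most \<open>m\<close> remaining indices it is at most
  \<open>c_max * max (h ^ 2) (h ^ m) * m ^ 2 / n\<close>.\<close>

section \<open>Bernstein expansions of polynomials\<close>

lemma bernstein_coeffs_monomial:
  fixes a b :: real
  assumes "a < b" and "l \<le> n"
  shows "bernstein_coeffs a b n (\<lambda>x. (x - a) ^ l)
           (\<lambda>k. (b - a) ^ l * (real (k choose l) / real (n choose l)))"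
  unfolding bernstein_coeffs_def
proof
  fix x :: real
  let ?s = "x - a" and ?r = "b - x" and ?h = "b - a"
  have pos: "real (n choose l) > 0" "?h > 0"
    using assms by simp_all
  have hpow: "?h ^ l * ?h ^ (n - l) = ?h ^ n"
    using assms(2) by (simp flip: power_add)
  have "?h ^ (n - l) = (?s + ?r) ^ (n - l)"
    by simp
  also have "\<dots> = (\<Sum>j\<le>n - l. real (n - l choose j) * ?s ^ j * ?r ^ (n - l - j))"
    by (rule binomial_ring)
  finally have "?s ^ l * ?h ^ (n - l)
      = (\<Sum>j\<le>n - l. real (n - l choose j) * ?s ^ (j + l) * ?r ^ (n - (j + l)))"
    by (simp add: sum_distrib_left power_add ac_simps)
  also have "\<dots> = (\<Sum>k=l..n. real (n - l choose (k - l)) * ?s ^ k * ?r ^ (n - k))"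
    by (rule sum.reindex_bij_witness[where i = "\<lambda>k. k - l" and j = "\<lambda>j. j + l"])
      (use assms(2) in auto)
  also have "\<dots> = (\<Sum>k=l..n. real (k choose l) / real (n choose l) * real (n choose k)
      * ?s ^ k * ?r ^ (n - k))"
  proof (rule sum.cong)
    fix k assume k: "k \<in> {l..n}"
    then have "real (n choose k) * real (k choose l) = real (n choose l) * real (n - l choose (k - l))"
      by (simp add: choose_mult flip: of_nat_mult)
    then have "real (n - l choose (k - l))
        = real (k choose l) / real (n choose l) * real (n choose k)"
      using pos by (simp add: field_simps)
    then show "real (n - l choose (k - l)) * ?s ^ k * ?r ^ (n - k)
        = real (k choose l) / real (n choose l) * real (n choose k) * ?s ^ k * ?r ^ (n - k)"
      by simp
  qed simp
  also have "\<dots> = (\<Sum>k=0..n. real (k choose l) / real (n choose l) * real (n choose k)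
      * ?s ^ k * ?r ^ (n - k))"
    by (rule sum.mono_neutral_left) auto
  finally have main: "?s ^ l * ?h ^ (n - l) = \<dots>" .
  have "?s ^ l = (?h ^ l / ?h ^ n) * (?s ^ l * ?h ^ (n - l))"
    using pos(2) by (simp add: field_simps flip: hpow)
  also have "\<dots> = (\<Sum>k=0..n. ?h ^ l * (real (k choose l) / real (n choose l)) * real (n choose k)
      * (?s ^ k * ?r ^ (n - k) / ?h ^ n))"
    unfolding main sum_distrib_left by (rule sum.cong) (simp_all add: mult_ac)
  finally show "?s ^ l = \<dots>" .
qed

text \<open>The substitution \<open>u = (x - a) / (b - x)\<close> maps \<open>[a, b)\<close> onto \<open>[0, \<infinity>)\<close> and turns a Bernstein
  expansion, divided by \<open>((b - x) / (b - a)) ^ n\<close>, into an ordinary polynomial in \<open>u\<close>.\<close>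

lemma bernstein_coeffs_unique:
  fixes a b :: real
  assumes "a < b" and v: "bernstein_coeffs a b n f v" and w: "bernstein_coeffs a b n f w"
    and "k \<le> n"
  shows "v k = w k"
proof -
  let ?d = "\<lambda>k. (v k - w k) * real (n choose k)"
  let ?h = "b - a"
  have zero: "(\<Sum>k\<le>n. ?d k * u ^ k) = 0" if u: "u \<ge> 0" for u :: real
  proof -
    define x where "x = a + ?h * (u / (1 + u))"
    have s: "x - a = ?h * u / (1 + u)" and r: "b - x = ?h / (1 + u)"
      using u by (simp_all add: x_def field_simps)
    have "x - a \<ge> 0" "b - x \<ge> 0"
      unfolding s r using assms(1) u by simp_all
    then have x: "x \<in> {a..b}" by simp
    have basis: "(x - a) ^ k * (b - x) ^ (n - k) / ?h ^ n = u ^ k / (1 + u) ^ n" if "k \<le> n" for k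
    proof -
      have split: "?h ^ k * ?h ^ (n - k) = ?h ^ n" "(1 + u) ^ k * (1 + u) ^ (n - k) = (1 + u) ^ n"
        using that by (simp_all flip: power_add)
      have "(x - a) ^ k * (b - x) ^ (n - k)
          = (?h ^ k * ?h ^ (n - k)) * u ^ k / ((1 + u) ^ k * (1 + u) ^ (n - k))"
        unfolding s r by (simp add: power_mult_distrib power_divide)
      then show ?thesis
        using assms(1) unfolding split by simp
    qed
    have "0 = (\<Sum>k=0..n. v k * real (n choose k) * ((x - a) ^ k * (b - x) ^ (n - k) / ?h ^ n))
        - (\<Sum>k=0..n. w k * real (n choose k) * ((x - a) ^ k * (b - x) ^ (n - k) / ?h ^ n))"
      using v w x unfolding bernstein_coeffs_def by auto
    also have "\<dots> = (\<Sum>k=0..n. ?d k * u ^ k / (1 + u) ^ n)"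
      unfolding sum_subtractf[symmetric]
      by (rule sum.cong) (simp_all add: basis algebra_simps diff_divide_distrib)
    also have "\<dots> = (\<Sum>k\<le>n. ?d k * u ^ k) / (1 + u) ^ n"
      by (simp add: sum_divide_distrib atMost_atLeast0)
    finally show ?thesis
      using u by simp
  qed
  have "infinite {0::real..}"
    by (rule infinite_Ici)
  moreover have "{0::real..} \<subseteq> {u. (\<Sum>k\<le>n. ?d k * u ^ k) = 0}"
    using zero by auto
  ultimately have "infinite {u. (\<Sum>k\<le>n. ?d k * u ^ k) = 0}"
    using finite_subset by blast
  then have "?d k = 0"
    using polyfun_finite_roots[of ?d n] \<open>k \<le> n\<close> by blast
  then show ?thesis
    using \<open>k \<le> n\<close> by simp
qed

lemma bernstein_coeffs_linear_combination:
  assumes "\<And>l. l \<in> A \<Longrightarrow> bernstein_coeffs a b n (f l) (v l)"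
  shows "bernstein_coeffs a b n (\<lambda>x. \<Sum>l\<in>A. c l * f l x) (\<lambda>k. \<Sum>l\<in>A. c l * v l k)"
  unfolding bernstein_coeffs_def
proof
  fix x assume x: "x \<in> {a..b}"
  let ?B = "\<lambda>k. real (n choose k) * ((x - a) ^ k * (b - x) ^ (n - k) / (b - a) ^ n)"
  have "(\<Sum>l\<in>A. c l * f l x) = (\<Sum>l\<in>A. \<Sum>k=0..n. c l * v l k * ?B k)"
    using assms x by (intro sum.cong) (auto simp: bernstein_coeffs_def sum_distrib_left mult.assoc)
  also have "\<dots> = (\<Sum>k=0..n. (\<Sum>l\<in>A. c l * v l k) * ?B k)"
    by (subst sum.swap) (simp only: sum_distrib_right)
  finally show "(\<Sum>l\<in>A. c l * f l x) = (\<Sum>k=0..n. (\<Sum>l\<in>A. c l * v l k) * real (n choose k)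
      * ((x - a) ^ k * (b - x) ^ (n - k) / (b - a) ^ n))"
    by (simp add: mult.assoc)
qed

section \<open>Ratios of binomial coefficients and powers\<close>

text \<open>The induction rests on
  \<open>p * p ^ l - q * t = p * (p ^ l - q) + q * (p - t)\<close>, where \<open>p = k / n\<close>, \<open>q\<close> is the ratio of the binomial
  coefficients for \<open>l\<close>, and \<open>t = (k - l) / (n - l)\<close>. The factor \<open>p - t\<close> lies between \<open>0\<close> and \<open>l / n\<close> only for
  \<open>l \<le> k\<close>, but \<open>q = 0\<close> otherwise.\<close>

lemma power_diff_binomial_ratio_bounds:
  fixes k n l :: nat
  assumes "k \<le> n" and "l \<le> n" and "n > 0"
  shows "0 \<le> (real k / real n) ^ l - real (k choose l) / real (n choose l)"
    and "(real k / real n) ^ l - real (k choose l) / real (n choose l)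
           \<le> real l * (real l - 1) / (2 * real n)"
proof -
  define p where "p = real k / real n"
  define q where "q l = real (k choose l) / real (n choose l)" for l
  have p: "0 \<le> p" "p \<le> 1"
    using assms by (simp_all add: p_def)
  have "0 \<le> p ^ l - q l \<and> p ^ l - q l \<le> real l * (real l - 1) / (2 * real n)"
    using assms(2)
  proof (induction l)
    case 0
    then show ?case by (simp add: q_def)
  next
    case (Suc l)
    then have ln: "l < n" by simp
    define t where "t = (real k - real l) / (real n - real l)"
    have absorb: "real (Suc l) * real (j choose Suc l) = (real j - real l) * real (j choose l)" for j
    proof (cases "l \<le> j")
      case True
      then show ?thesis
        using binomial_absorb_comp[of j l] binomial_absorption[of l j]
        by (metis of_nat_diff of_nat_mult)
    qed (simp add: binomial_eq_0)
    have q_Suc: "q (Suc l) = q l * t"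
    proof -
      have "q (Suc l) = (real (Suc l) * real (k choose Suc l)) / (real (Suc l) * real (n choose Suc l))"
        unfolding q_def by simp
      also have "\<dots> = q l * t"
        unfolding absorb q_def t_def by (simp add: mult.commute)
      finally show ?thesis .
    qed
    have step: "p ^ Suc l - q (Suc l) = p * (p ^ l - q l) + q l * (p - t)"
      unfolding q_Suc by (simp add: algebra_simps)
    have q01: "0 \<le> q l" "q l \<le> 1"
    proof -
      show "0 \<le> q l" by (simp add: q_def)
      have "k choose l \<le> n choose l"
        using assms(1) by (rule binomial_right_mono)
      then show "q l \<le> 1"
        using ln by (simp add: q_def)
    qed
    have second: "0 \<le> q l * (p - t) \<and> q l * (p - t) \<le> real l / real n"
    proof (cases "l \<le> k")
      case True
      have diff: "p - t = (real l / real n) * ((real n - real k) / (real n - real l))"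
        using ln assms(3) unfolding p_def t_def by (simp add: field_simps)
      have "0 \<le> (real n - real k) / (real n - real l)" "(real n - real k) / (real n - real l) \<le> 1"
        using True assms(1) ln by simp_all
      then have "0 \<le> p - t" "p - t \<le> real l / real n"
        unfolding diff by (intro mult_nonneg_nonneg mult_left_le; simp)+
      then show ?thesis
        using q01 by (meson mult_left_le_one_le mult_nonneg_nonneg order_trans)
    next
      case False
      then show ?thesis by (simp add: q_def binomial_eq_0)
    qed
    have IH: "0 \<le> p ^ l - q l" "p ^ l - q l \<le> real l * (real l - 1) / (2 * real n)"
      using Suc by simp_all
    have "0 \<le> p * (p ^ l - q l)" "p * (p ^ l - q l) \<le> p ^ l - q l"
      using IH(1) p by (simp_all add: mult_left_le_one_le)
    moreover have "real l * (real l - 1) / (2 * real n) + real l / real n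
        = real (Suc l) * (real (Suc l) - 1) / (2 * real n)"
      using assms(3) by (simp add: field_simps)
    ultimately show ?case
      using step second IH by linarith
  qed
  then show "0 \<le> (real k / real n) ^ l - real (k choose l) / real (n choose l)"
    and "(real k / real n) ^ l - real (k choose l) / real (n choose l)
           \<le> real l * (real l - 1) / (2 * real n)"
    unfolding p_def q_def by simp_all
qed

section \<open>Distance between node values and coefficients\<close>

lemma abs_le_c_max:
  assumes "2 \<le> l" and "l \<le> m"
  shows "\<bar>c l\<bar> \<le> c_max c m"
  using assms unfolding c_max_def by (auto intro!: Max_ge)

lemma power_le_max_power:
  fixes h :: real
  assumes "0 \<le> h" and "i \<le> l" and "l \<le> m"
  shows "h ^ l \<le> max (h ^ i) (h ^ m)"
proof (cases "h \<le> 1")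
  case True
  then have "h ^ l \<le> h ^ i"
    using assms by (intro power_decreasing) auto
  then show ?thesis by simp
next
  case False
  then have "h ^ l \<le> h ^ m"
    using assms by (intro power_increasing) auto
  then show ?thesis by simp
qed

theorem theorem5p4:
  fixes a b :: real and g :: "real poly" and c w :: "nat \<Rightarrow> real" and m n k :: nat
  assumes "a < b"
    and "degree g = m"
    and "\<And>x. poly g x = (\<Sum>l=0..m. c l * (x - a) ^ l)"
    and "n > m"
    and "bernstein_coeffs a b n (poly g) w"
    and "k \<le> n"
  shows "\<bar>poly g (a + real k / real n * (b - a)) - w k\<bar>
           \<le> real m ^ 3 * c_max c m * max ((b - a) ^ 2) ((b - a) ^ m) / real n"
proof -
  define h where "h = b - a"
  define C where "C = c_max c m"
  define M where "M = max (h ^ 2) (h ^ m)"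
  define D where "D l = (real k / real n) ^ l - real (k choose l) / real (n choose l)" for l
  have h: "h > 0" using assms(1) by (simp add: h_def)
  have "w k = (\<Sum>l=0..m. c l * (h ^ l * (real (k choose l) / real (n choose l))))"
  proof (rule bernstein_coeffs_unique[OF assms(1) assms(5) _ assms(6)])
    have "poly g = (\<lambda>x. \<Sum>l=0..m. c l * (x - a) ^ l)"
      using assms(3) by blast
    then show "bernstein_coeffs a b n (poly g)
        (\<lambda>k. \<Sum>l=0..m. c l * (h ^ l * (real (k choose l) / real (n choose l))))"
      using assms(1,4) unfolding h_def
      by (simp only:)
        (intro bernstein_coeffs_linear_combination bernstein_coeffs_monomial, auto)
  qed
  moreover have "poly g (a + real k / real n * (b - a)) = (\<Sum>l=0..m. c l * (h ^ l * (real k / real n) ^ l))"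
    unfolding assms(3) h_def by (simp add: power_mult_distrib power_divide mult_ac)
  ultimately have diff: "poly g (a + real k / real n * (b - a)) - w k = (\<Sum>l=0..m. c l * h ^ l * D l)"
    by (simp add: D_def sum_subtractf algebra_simps)
  have D: "0 \<le> D l" "D l \<le> real l * (real l - 1) / (2 * real n)" if "l \<le> m" for l
    using power_diff_binomial_ratio_bounds[of k n l] that assms(4,6) unfolding D_def by auto
  have D_zero: "D l = 0" if "l \<le> m" "l < 2" for l
    using D[OF that(1)] that(2) by (cases l) auto
  have term_le: "\<bar>c l * h ^ l * D l\<bar> \<le> C * M * (real m ^ 2 / real n)" if l: "l \<in> {2..m}" for l
  proof -
    have "D l \<le> real l * (real l - 1) / (2 * real n)"
      using D(2) l by simp
    also have "\<dots> \<le> real m ^ 2 / real n"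
    proof -
      have "real l * (real l - 1) \<le> real m * real m"
        using l by (intro mult_mono) auto
      then have "real l * (real l - 1) / (2 * real n) \<le> real m * real m / (2 * real n)"
        by (rule divide_right_mono) simp
      also have "\<dots> \<le> real m * real m / real n"
        using assms(4) by (intro divide_left_mono) auto
      finally show ?thesis by (simp add: power2_eq_square)
    qed
    finally have "D l \<le> real m ^ 2 / real n" .
    moreover have "\<bar>c l\<bar> \<le> C" "h ^ l \<le> M"
      using l h abs_le_c_max power_le_max_power[of h 2 l m] by (auto simp: C_def M_def)
    ultimately have "\<bar>c l\<bar> * h ^ l * D l \<le> C * M * (real m ^ 2 / real n)"
      using D(1)[of l] l h by (intro mult_mono) (auto simp: M_def max_def)
    then show ?thesis
      using D(1)[of l] l h by (simp add: abs_mult)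
  qed
  have "\<bar>poly g (a + real k / real n * (b - a)) - w k\<bar> = \<bar>\<Sum>l=2..m. c l * h ^ l * D l\<bar>"
    unfolding diff
    by (intro arg_cong[where f = abs] sum.mono_neutral_right) (auto simp: D_zero)
  also have "\<dots> \<le> (\<Sum>l=2..m. \<bar>c l * h ^ l * D l\<bar>)"
    by (rule sum_abs)
  also have "\<dots> \<le> (\<Sum>l=2..m. C * M * (real m ^ 2 / real n))"
    using term_le by (rule sum_mono)
  also have "\<dots> = real (m - 1) * (C * M * (real m ^ 2 / real n))"
    by simp
  also have "\<dots> \<le> real m * (C * M * (real m ^ 2 / real n))"
  proof (rule mult_right_mono)
    have "0 \<le> C"
    proof (cases "m < 2")
      case True
      then show ?thesis by (simp add: C_def c_max_def)
    next
      case False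
      then have "\<bar>c m\<bar> \<le> C"
        unfolding C_def by (intro abs_le_c_max) auto
      then show ?thesis by linarith
    qed
    moreover have "0 \<le> M"
      using h by (simp add: M_def max_def)
    ultimately show "0 \<le> C * M * (real m ^ 2 / real n)" by simp
  qed simp
  finally show ?thesis
    by (simp add: C_def M_def h_def power2_eq_square power3_eq_cube mult_ac)
qed

end
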